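(* Let $A$ be a real $m\times n$ matrix and $b\in\mathbb{R}^m$. Let $T$ and $R$ be real matrices of dimensions $n\times n$ and $n\times m$, respectively, such that (i) $T+RA=I$; (ii) $Ry\in\mathcal{R}(A^T)$ for every $y\in\mathbb{R}^m$; (iii) $\tilde T:=TP_{\mathcal{R}(A^T)}$ satisfies $\|\tilde T\|<1$. Let $Q:\mathbb{R}^n\to\mathbb{R}^n$ be $Q(x):=Tx+Rb$, and let $\Delta:=(I-\tilde T)^{-1}RP_{\mathcal{N}(A^T)}(b)$. Let $\{C_k\}_{k=0}^{\infty}$ be a family of metric projection operators, $C_k$ being the projection onto a box $[a_k,b_k]\subset\mathbb{R}^n$, such that (a) for all $k\ge 0$ the set $\mathcal{V}_k^{*}:=\{z\in\operatorname{Im}(C_k)\mid z-\Delta\in LSS(A;b)\}$ is nonempty; (b) for every $\ell\ge 0$ there exists $k(\ell)\ge\ell$ such that $\operatorname{Im}(C_{k+1})\subseteq\operatorname{Im}(C_\ell)$ for all $k\ge k(\ell)$. Put $T_k:=C_kQ$ (composition), $k\ge 0$. Then: (1) $F:=\bigcap_{k=0}^{\infty}\{x\in\mathbb{R}^n\mid T_k(x)=x\}\ne\emptyset$; (2) for any sequence $\{x^k\}_{k=0}^{\infty}$ generated by $x^0\in\mathbb{R}^n$ arbitrary and $x^{k+1}=T_{k+1}(x^k)$, $k\ge 0$, and for every $\ell\ge 0$, there exists an index $k(\ell)\ge 0$ such that $\|T_{k+1}(x^k)-z\|\le\|T_\ell(x^k)-z\|$ for all $z\in F$ and all $k\ge 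k(\ell)$.
   Context: $\|\cdot\|$ is the Euclidean norm on vectors and the induced (spectral) norm on matrices. $I$ is the identity matrix, $A^T$ is the transpose of $A$, $\mathcal{R}(\cdot)$ and $\mathcal{N}(\cdot)$ denote range and null space, and $P_V$ is the orthogonal projection onto a linear subspace $V$. $I-\tilde T$ is invertible since $\|\tilde T\|<1$. $LSS(A;b)$ is the set of all least squares solutions, i.e. of all $x\in\mathbb{R}^n$ with $\|Ax-b\|=\min\{\|Az-b\|\mid z\in\mathbb{R}^n\}$. For $a,b\in\mathbb{R}^n$ with $a_i\le b_i$ for all $i$, the metric projection operator $C$ onto the (closed, bounded) box $[a,b]=[a_1,b_1]\times\cdots\times[a_n,b_n]$ is defined componentwise by $(Cx)_i=x_i$ if $x_i\in[a_i,b_i]$, $(Cx)_i=a_i$ if $x_i<a_i$, $(Cx)_i=b_i$ if $x_i>b_i$. $\operatorname{Im}(C)$ denotes its image, which is the box $[a,b]$. (The box endpoints $a_k,b_k$ are unrelated to the data vector $b\in\mathbb{R}^m$.) *)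

theory Defs
  imports "HOL-Analysis.Analysis"
begin

definition orth_proj :: "'a::euclidean_space set \<Rightarrow> 'a \<Rightarrow> 'a" where
  "orth_proj V x = (THE p. p \<in> V \<and> (\<forall>v\<in>V. orthogonal (x - p) v))"

lemma orth_proj_eqI:
  assumes "subspace V" "p \<in> V" "\<And>v. v \<in> V \<Longrightarrow> orthogonal (x - p) v"
  shows "orth_proj V x = p"
  unfolding orth_proj_def
proof (rule the_equality)
  show "p \<in> V \<and> (\<forall>v\<in>V. orthogonal (x - p) v)"
    using assms by blast
next
  fix q assume q: "q \<in> V \<and> (\<forall>v\<in>V. orthogonal (x - q) v)"
  have "q - p \<in> V"
    using assms q by (simp add: subspace_diff)
  then have "(x - p) \<bullet> (q - p) = 0" "(x - q) \<bullet> (q - p) = 0"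
    using assms(3) q by (auto simp: orthogonal_def)
  then have "(q - p) \<bullet> (q - p) = 0"
    by (simp add: inner_diff_left)
  then show "q = p"
    by simp
qed

lemma
  assumes "subspace V"
  shows orth_proj_in: "orth_proj V x \<in> V"
    and orth_proj_orthogonal: "v \<in> V \<Longrightarrow> orthogonal (x - orth_proj V x) v"
proof -
  obtain y z where "y \<in> span V" "\<And>w. w \<in> span V \<Longrightarrow> orthogonal z w" "x = y + z"
    using orthogonal_subspace_decomp_exists[of V x] by blast
  moreover have "span V = V"
    using assms by (simp add: span_eq_iff)
  ultimately have yz: "y \<in> V" "\<And>w. w \<in> V \<Longrightarrow> orthogonal (x - y) w"
    by auto
  have "orth_proj V x = y"
    using assms yz by (rule orth_proj_eqI)
  with yz show "orth_proj V x \<in> V" "v \<in> V \<Longrightarrow> orthogonal (x - orth_proj V x) v"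
    by auto
qed

lemma linear_orth_proj:
  assumes "subspace V"
  shows "linear (orth_proj V)"
proof (rule linearI)
  fix x y and c :: real
  show "orth_proj V (x + y) = orth_proj V x + orth_proj V y"
  proof (rule orth_proj_eqI[OF assms])
    show "orth_proj V x + orth_proj V y \<in> V"
      using assms by (simp add: orth_proj_in subspace_add)
    fix v assume "v \<in> V"
    then show "orthogonal (x + y - (orth_proj V x + orth_proj V y)) v"
      using orth_proj_orthogonal[OF assms, of v x] orth_proj_orthogonal[OF assms, of v y]
      by (simp add: orthogonal_def inner_diff_left inner_add_left)
  qed
  show "orth_proj V (c *\<^sub>R x) = c *\<^sub>R orth_proj V x"
  proof (rule orth_proj_eqI[OF assms])
    show "c *\<^sub>R orth_proj V x \<in> V"
      using assms by (simp add: orth_proj_in subspace_scale)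
    fix v assume "v \<in> V"
    then show "orthogonal (c *\<^sub>R x - c *\<^sub>R orth_proj V x) v"
      using orth_proj_orthogonal[OF assms, of v x]
      by (simp add: orthogonal_def inner_diff_left)
  qed
qed

definition LSS :: "real^'n^'m \<Rightarrow> real^'m \<Rightarrow> (real^'n) set" where
  "LSS A b = {x. is_arg_min (\<lambda>z. norm (A *v z - b)) (\<lambda>_. True) x}"

definition mat_range :: "real^'n^'m \<Rightarrow> (real^'m) set" where
  "mat_range A = range ((*v) A)"

definition null_space :: "real^'n^'m \<Rightarrow> (real^'n) set" where
  "null_space A = {x. A *v x = 0}"

lemma subspace_mat_range: "subspace (mat_range A)"
  by (simp add: mat_range_def linear_subspace_image)

lemma subspace_null_space: "subspace (null_space A)"
  by (simp add: null_space_def linear_subspace_kernel)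

(* HOL-Analysis instantiates norm on matrices as the Frobenius norm, so the spectral norm
   has to be the operator norm of the associated linear map. *)
definition spectral_norm :: "real^'n^'m \<Rightarrow> real" where
  "spectral_norm M = onorm ((*v) M)"

definition T_tilde :: "real^'n^'m \<Rightarrow> real^'n^'n \<Rightarrow> real^'n^'n" where
  "T_tilde A T = T ** matrix (orth_proj (mat_range (transpose A)))"

definition Q_map :: "real^'n^'n \<Rightarrow> real^'m^'n \<Rightarrow> real^'m \<Rightarrow> real^'n \<Rightarrow> real^'n" where
  "Q_map T R b x = T *v x + R *v b"

definition Delta :: "real^'n^'m \<Rightarrow> real^'n^'n \<Rightarrow> real^'m^'n \<Rightarrow> real^'m \<Rightarrow> real^'n" where
  "Delta A T R b =
    matrix_inv (mat 1 - T_tilde A T) *v (R *v orth_proj (null_space (transpose A)) b)"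

(* The metric projection onto a box [lo, hi] is the library function clamp. *)
lemma clamp_nth:
  fixes lo hi x :: "real^'n"
  assumes "\<And>i. lo $ i \<le> hi $ i"
  shows "clamp lo hi x $ i =
    (if x $ i < lo $ i then lo $ i else if x $ i \<le> hi $ i then x $ i else hi $ i)"
proof -
  have le: "\<forall>u\<in>Basis. lo \<bullet> u \<le> hi \<bullet> u"
    using assms by (auto simp: Basis_vec_def inner_axis)
  have "clamp lo hi x \<bullet> axis i 1 =
    (if x \<bullet> axis i 1 < lo \<bullet> axis i 1 then lo \<bullet> axis i 1
     else if x \<bullet> axis i 1 \<le> hi \<bullet> axis i 1 then x \<bullet> axis i 1 else hi \<bullet> axis i 1)"
    unfolding clamp_def using le by (simp add: axis_in_Basis_iff)
  then show ?thesis
    by (simp add: inner_axis)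
qed

end

theory Submission
  imports Defs
begin

text \<open>
  If \<open>x\<close> is a least squares solution, then \<open>x + \<Delta>\<close> is a fixed point of \<open>Q\<close>: the residual \<open>b - A x\<close>
  is the projection of \<open>b\<close> onto \<open>\<N>(A\<^sup>T)\<close>, and \<open>\<Delta>\<close> lies in \<open>\<R>(A\<^sup>T)\<close>, where \<open>T\<close> and \<open>T\<close>-tilde agree.
  So each box contains a fixed point of \<open>Q\<close>; since any finitely many boxes contain a common later
  box, compactness yields a fixed point of \<open>Q\<close> lying in all boxes.
  The norm inequality needs nothing about \<open>Q\<close>: for nested boxes, clamping to the larger box
  and then to the smaller one is clamping to the smaller one, which is nonexpansive and fixes
  the points of the smaller box.
\<close>

text \<open>\<open>A *v x\<close> is a point of the subspace \<open>mat_range A\<close> closest to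
  \<open>b\<close>, so the obtuse angle criterion for convex sets applies. Using it in the
  directions \<open>w\<close> and \<open>- w\<close> turns the inequality into
  orthogonality.\<close>

lemma LSS_normal_equation:
  assumes "x \<in> LSS A b"
  shows "transpose A *v (b - A *v x) = 0"
proof -
  have ort: "(b - A *v x) \<bullet> (A *v w) = 0" for w
  proof -
    have "(b - A *v x) \<bullet> (A *v (x + u) - A *v x) \<le> 0" for u
    proof (rule any_closest_point_dot[where S = "mat_range A"])
      show "\<forall>z\<in>mat_range A. dist b (A *v x) \<le> dist b z"
        using assms by (auto simp: mat_range_def LSS_def is_arg_min_linorder dist_norm norm_minus_commute)
    qed (use subspace_mat_range[of A] in \<open>simp_all add: subspace_imp_convex closed_subspace\<close>,
        auto simp: mat_range_def)
    from this[of w] this[of "- w"] show ?thesis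
      by (simp add: matrix_vector_right_distrib matrix_vector_mult_diff_distrib)
  qed
  have "(transpose A *v (b - A *v x)) \<bullet> w = 0" for w
    using ort[of w] by (metis dot_lmul_matrix transpose_matrix_vector)
  then show ?thesis
    by (metis inner_eq_zero_iff)
qed

lemma orth_proj_null_space_LSS:
  assumes "x \<in> LSS A b"
  shows "orth_proj (null_space (transpose A)) b = b - A *v x"
proof (rule orth_proj_eqI[OF subspace_null_space])
  show "b - A *v x \<in> null_space (transpose A)"
    using LSS_normal_equation[OF assms] by (simp add: null_space_def)
  fix v assume "v \<in> null_space (transpose A)"
  then have "v \<bullet> (A *v x) = 0"
    by (metis (mono_tags) dot_lmul_matrix inner_zero_left mem_Collect_eq null_space_def transpose_matrix_vector)
  then show "orthogonal (b - (b - A *v x)) v"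
    by (simp add: orthogonal_def inner_commute)
qed

text \<open>A nonzero kernel vector would be a fixed point of \<open>M\<close>, which a map of
  operator norm below 1 cannot have.\<close>

lemma invertible_id_minus:
  fixes M :: "real^'n^'n"
  assumes "spectral_norm M < 1"
  shows "invertible (mat 1 - M)"
proof -
  have "v = 0" if "(mat 1 - M) *v v = 0" for v
  proof (rule ccontr)
    assume "v \<noteq> 0"
    have "v = M *v v"
      using that by (simp add: matrix_vector_mult_diff_rdistrib)
    then have "norm v \<le> spectral_norm M * norm v"
      by (metis spectral_norm_def onorm matrix_vector_mul_bounded_linear)
    also have "\<dots> < norm v"
      using assms \<open>v \<noteq> 0\<close> by simp
    finally show False by simp
  qed
  then show ?thesis
    by (metis invertible_left_inverse matrix_left_invertible_ker)
qed

lemma T_tilde_mult: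
  "T_tilde A T *v x = T *v orth_proj (mat_range (transpose A)) x"
  by (simp add: T_tilde_def matrix_works linear_orth_proj subspace_mat_range
      flip: matrix_vector_mul_assoc)

text \<open>The definition of \<Delta> only gives this equation with \<open>T_tilde A T\<close> in
  place of \<open>T\<close>. The two agree on \<Delta> once \<Delta> is known to lie in the range of
  \<open>transpose A\<close>.\<close>

lemma Delta_eq:
  assumes "T + R ** A = mat 1"
    and R: "\<And>y. R *v y \<in> mat_range (transpose A)"
    and "spectral_norm (T_tilde A T) < 1"
  shows "Delta A T R b = T *v Delta A T R b + R *v orth_proj (null_space (transpose A)) b"
proof -
  let ?D = "Delta A T R b" and ?V = "mat_range (transpose A)"
    and ?r = "R *v orth_proj (null_space (transpose A)) b"
  have "(mat 1 - T_tilde A T) ** matrix_inv (mat 1 - T_tilde A T) = mat 1"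
    using someI_ex[OF invertible_id_minus[OF assms(3), unfolded invertible_def]]
    by (simp add: matrix_inv_def)
  then have "(mat 1 - T_tilde A T) *v ?D = ?r"
    by (metis Delta_def matrix_vector_mul_assoc matrix_vector_mul_lid)
  then have D: "?D = T *v orth_proj ?V ?D + ?r"
    by (simp add: matrix_vector_mult_diff_rdistrib T_tilde_mult algebra_simps)
  \<comment> \<open>Written this way, \<open>T\<close> visibly maps \<open>?V\<close> into itself,
    because all values of \<open>R\<close> lie in \<open>?V\<close>. Both summands in
    \<open>D\<close> are then in \<open>?V\<close>.\<close>
  have "T = mat 1 - R ** A"
    using assms(1) by (simp add: eq_diff_eq)
  then have "T *v orth_proj ?V ?D = orth_proj ?V ?D - R *v (A *v orth_proj ?V ?D)"
    by (simp add: matrix_vector_mult_diff_rdistrib matrix_vector_mul_assoc)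
  then have "T *v orth_proj ?V ?D \<in> ?V"
    by (simp add: R orth_proj_in subspace_diff subspace_mat_range)
  then have "?D \<in> ?V"
    by (subst D) (simp add: R subspace_add subspace_mat_range)
  then have "orth_proj ?V ?D = ?D"
    by (intro orth_proj_eqI) (auto simp: subspace_mat_range orthogonal_def)
  with D show ?thesis by simp
qed

text \<open>With \<open>z = x + ?D\<close>, substitute \<open>T *v x = x - R *v (A *v x)\<close> and
  \<open>T *v ?D = ?D - R *v (b - A *v x)\<close>; all terms with \<open>R\<close> cancel against
  \<open>R *v b\<close>.\<close>

lemma Q_map_fixed_point:
  assumes TR: "T + R ** A = mat 1"
    and "\<And>y. R *v y \<in> mat_range (transpose A)"
    and "spectral_norm (T_tilde A T) < 1"
    and z: "z - Delta A T R b \<in> LSS A b"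
  shows "Q_map T R b z = z"
proof -
  let ?D = "Delta A T R b"
  define x where "x = z - ?D"
  have "?D = T *v ?D + R *v (b - A *v x)"
    using Delta_eq[OF assms(1-3), of b] orth_proj_null_space_LSS[OF z] by (simp add: x_def)
  moreover have "T *v x + R *v (A *v x) = x"
    by (metis TR matrix_vector_mul_assoc matrix_vector_mul_lid matrix_vector_mult_add_rdistrib)
  moreover have "Q_map T R b z = T *v x + T *v ?D + R *v b"
    by (simp add: Q_map_def x_def flip: matrix_vector_right_distrib)
  ultimately show ?thesis
    by (simp add: x_def matrix_vector_mult_diff_distrib algebra_simps)
qed

lemma range_clamp:
  fixes lo hi :: "real^'n"
  assumes "\<And>i. lo $ i \<le> hi $ i"
  shows "range (clamp lo hi) = cbox lo hi"
proof
  show "range (clamp lo hi) \<subseteq> cbox lo hi"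
    using assms by (auto simp: mem_box_cart clamp_nth)
  show "cbox lo hi \<subseteq> range (clamp lo hi)"
    by (metis clamp_cancel_cbox rangeI subsetI)
qed

text \<open>The first clamp moves a coordinate only to an endpoint on the same side of the smaller
  interval, so the second clamp gives the same result.\<close>

lemma clamp_clamp_subset:
  fixes lo hi lo' hi' x :: "real^'n"
  assumes le: "\<And>i. lo $ i \<le> hi $ i" "\<And>i. lo' $ i \<le> hi' $ i"
    and sub: "cbox lo' hi' \<subseteq> cbox lo hi"
  shows "clamp lo' hi' (clamp lo hi x) = clamp lo' hi' x"
proof (rule vec_eq_iff[THEN iffD2, rule_format])
  fix i
  \<comment> \<open>The corners of the smaller box turn the inclusion into componentwise
    inequalities.\<close>
  have "lo' \<in> cbox lo hi" "hi' \<in> cbox lo hi"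
    by (rule subsetD[OF sub], simp add: mem_box_cart le)+
  then have "lo $ i \<le> lo' $ i" "hi' $ i \<le> hi $ i"
    by (auto simp: mem_box_cart)
  with le(2)[of i] show "clamp lo' hi' (clamp lo hi x) $ i = clamp lo' hi' x $ i"
    by (smt (verit) clamp_nth le)
qed

lemma norm_clamp_subset_le:
  fixes lo hi lo' hi' x z :: "real^'n"
  assumes "\<And>i. lo $ i \<le> hi $ i" "\<And>i. lo' $ i \<le> hi' $ i"
    and "cbox lo' hi' \<subseteq> cbox lo hi" and "z \<in> cbox lo' hi'"
  shows "norm (clamp lo' hi' x - z) \<le> norm (clamp lo hi x - z)"
proof -
  have "dist (clamp lo' hi' (clamp lo hi x)) (clamp lo' hi' z) \<le> dist (clamp lo hi x) z"
    by (rule dist_clamps_le_dist_args)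
  then show ?thesis
    using assms by (simp add: clamp_clamp_subset dist_norm)
qed

text \<open>The sets need not be decreasing, but finitely many of them always contain a common later
  one, which gives the finite intersection property.\<close>

lemma Inter_compact_eventually_subset_nonempty:
  fixes K :: "nat \<Rightarrow> 'a::t2_space set"
  assumes "\<And>k. compact (K k)" "\<And>k. K k \<noteq> {}"
    and ev: "\<And>l. eventually (\<lambda>k. K k \<subseteq> K l) sequentially"
  shows "(\<Inter>k. K k) \<noteq> {}"
proof -
  have "K 0 \<inter> (\<Inter>k\<in>UNIV. K k) \<noteq> {}"
  proof (rule compact_imp_fip_image)
    fix I :: "nat set" assume "finite I"
    \<comment> \<open>The index 0 is added because \<open>K 0\<close> is the ambient compact
      set.\<close>
    then have "eventually (\<lambda>k. \<forall>l\<in>insert 0 I. K k \<subseteq> K l) sequentially"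
      using ev by (simp add: eventually_ball_finite eventually_conj)
    then obtain k where "\<forall>l\<in>insert 0 I. K k \<subseteq> K l"
      using eventually_happens'[OF sequentially_bot] by blast
    with assms(2)[of k] show "K 0 \<inter> \<Inter>(K ` I) \<noteq> {}" by blast
  qed (use assms in \<open>auto simp: compact_imp_closed\<close>)
  then show ?thesis by blast
qed

theorem proposition7:
  fixes A :: "real^'n^'m" and b :: "real^'m"
    and T :: "real^'n^'n" and R :: "real^'m^'n"
    and lo hi :: "nat \<Rightarrow> real^'n"
    and C TT :: "nat \<Rightarrow> real^'n \<Rightarrow> real^'n"
    and F :: "(real^'n) set"
  assumes "T + R ** A = mat 1"
    and "\<And>y. R *v y \<in> mat_range (transpose A)"
    and "spectral_norm (T_tilde A T) < 1"
    and "\<And>k i. lo k $ i \<le> hi k $ i"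
    and "\<And>k. C k = clamp (lo k) (hi k)"
    and "\<And>k. {z \<in> range (C k). z - Delta A T R b \<in> LSS A b} \<noteq> {}"
    and "\<And>l. \<exists>kl\<ge>l. \<forall>k\<ge>kl. range (C (k + 1)) \<subseteq> range (C l)"
    and "\<And>k. TT k = C k \<circ> Q_map T R b"
    and "F = (\<Inter>k. {x. TT k x = x})"
  shows "F \<noteq> {} \<and>
    (\<forall>x :: nat \<Rightarrow> real^'n. (\<forall>k. x (k + 1) = TT (k + 1) (x k)) \<longrightarrow>
      (\<forall>l. \<exists>kl. \<forall>z\<in>F. \<forall>k\<ge>kl.
        norm (TT (k + 1) (x k) - z) \<le> norm (TT l (x k) - z)))"
proof (intro conjI allI impI)
  have range_C: "range (C k) = cbox (lo k) (hi k)" for k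
    using assms(4,5) by (simp add: range_clamp)
  have ev_box: "eventually (\<lambda>k. cbox (lo k) (hi k) \<subseteq> cbox (lo l) (hi l)) sequentially" for l
  proof -
    from assms(7)[of l] obtain kl where "\<forall>k\<ge>kl. range (C (k + 1)) \<subseteq> range (C l)" by blast
    \<comment> \<open>The inclusions concern index \<open>k + 1\<close>, hence the shift by
      one.\<close>
    then show ?thesis
      by (subst eventually_sequentially_Suc[symmetric])
        (auto simp: eventually_sequentially range_C)
  qed
  show "F \<noteq> {}"
  proof -
    define K where "K k = cbox (lo k) (hi k) \<inter> {z. Q_map T R b z = z}" for k
    have "closed {z. Q_map T R b z = z}"
      unfolding Q_map_def
      by (intro closed_Collect_eq continuous_intros matrix_vector_mult_linear_continuous_on)
    then have "compact (K k)" for k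
      by (simp add: K_def compact_Int_closed)
    moreover have "K k \<noteq> {}" for k
      using assms(6)[of k] Q_map_fixed_point[OF assms(1-3)] by (auto simp: K_def range_C)
    moreover have "eventually (\<lambda>k. K k \<subseteq> K l) sequentially" for l
      using ev_box[of l] by eventually_elim (auto simp: K_def)
    ultimately have "(\<Inter>k. K k) \<noteq> {}"
      by (rule Inter_compact_eventually_subset_nonempty)
    then obtain z where "\<And>k. z \<in> K k" by blast
    \<comment> \<open>\<open>Q_map T R b\<close> fixes \<open>z\<close>, and so does each clamp, as
      \<open>z\<close> lies in every box.\<close>
    then have "TT k z = z" for k
      by (simp add: K_def assms(5,8))
    then show ?thesis
      unfolding assms(9) by blast
  qed
next
  fix x :: "nat \<Rightarrow> real^'n" and l
  \<comment> \<open>This index depends on \<open>l\<close> alone, so it serves all \<open>z\<close>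
    in \<open>F\<close> at once.\<close>
  obtain kl where kl: "\<And>k. k \<ge> kl \<Longrightarrow> range (C (k + 1)) \<subseteq> range (C l)"
    using assms(7)[of l] by blast
  have "norm (TT (k + 1) (x k) - z) \<le> norm (TT l (x k) - z)" if "z \<in> F" "k \<ge> kl" for z k
  proof -
    \<comment> \<open>As a value of \<open>C (k + 1)\<close>, the point \<open>z\<close> lies in the
      smaller box.\<close>
    have "z = C (k + 1) (Q_map T R b z)"
      using that(1) assms(8,9) by (auto dest: spec[of _ "k + 1"])
    then have "z \<in> range (C (k + 1))" by blast
    then show ?thesis
      using kl[OF that(2)] assms(4,5) by (simp add: assms(8) range_clamp norm_clamp_subset_le)
  qed
  then show "\<exists>kl. \<forall>z\<in>F. \<forall>k\<ge>kl. norm (TT (k + 1) (x k) - z) \<le> norm (TT l (x k) - z)"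
    by blast
qed

end
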